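(* Let $A=[a_{ij}]\in\mathbb{R}^{n\times n}$ be a nonnegative matrix with zero diagonal and let $\alpha_{ij}\in(0,1)$ be given for all $i$ and all $j\in N_i=\{j\ne i: a_{ij}>0\}$. Consider the system $\dot x_i(t)=u_i(t)$, $i=1,\dots,n$, with $x_i(t)\in\mathbb{R}$ and $$u_i=\sum_{j\in N_i}a_{ij}\operatorname{sig}(x_j-x_i)^{\alpha_{ij}}$$ (with $u_i=0$ if $N_i=\emptyset$). Suppose that $\mathcal{G}(A)$ is undirected and connected, and that $\alpha_{ij}=\alpha_{ji}$ for all $i$ and all $j\in N_i$. Then the system solves the finite-time average-consensus problem: it solves a finite-time consensus problem and the final common state is $\frac1n\sum_{i=1}^n x_i(0)$.
   Context: For $r\in\mathbb{R}$ and $\alpha>0$, $\operatorname{sig}(r)^\alpha:=\operatorname{sign}(r)|r|^\alpha$, with $\operatorname{sign}(0)=0$. The weighted directed graph $\mathcal{G}(A)$ has vertices $v_1,\dots,v_n$ and an edge $(v_i,v_j)$ if and only if $a_{ji}>0$; it is called undirected if $A^T=A$, and an undirected graph is connected if any two distinct vertices are joined by a path. Solutions are differentiable functions on $[0,\infty)$. The system solves a finite-time consensus problem if for every initial state $x(0)\in\mathbb{R}^n$ and every solution $x(t)$ on $[0,\infty)$ with that initial state, $|x_j(t)-x_k(t)|\to0$ as $t\to\infty$ for all $j,k$, and there exist a time $t^*$ and a real number $\kappa$ (the final common state) such that $x_j(t)=\kappa$ for all $t\ge t^*$ and all $j$. *)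

theory Defs
  imports "HOL-Analysis.Analysis" "Graph_Theory.Digraph"
begin

definition sig :: "real \<Rightarrow> real \<Rightarrow> real" where
  "sig r \<alpha> = sgn r * \<bar>r\<bar> powr \<alpha>"

text \<open>Vertices are the indices of the matrix. Note the index reversal: an arc \<open>(i, j)\<close> is
  weighted by the \<open>(j, i)\<close> entry.\<close>

definition weighted_graph :: "real^'n^'n \<Rightarrow> ('n, 'n \<times> 'n) pre_digraph" where
  "weighted_graph A = \<lparr> verts = UNIV, arcs = {(i, j). A $ j $ i > 0}, tail = fst, head = snd \<rparr>"

definition undirected :: "real^'n^'n \<Rightarrow> bool" where
  "undirected A \<longleftrightarrow> transpose A = A"

definition graph_connected :: "('n, 'n \<times> 'n) pre_digraph \<Rightarrow> bool" where
  "graph_connected G \<longleftrightarrow>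
     (\<forall>u\<in>verts G. \<forall>v\<in>verts G. u \<noteq> v \<longrightarrow> u \<rightarrow>\<^sup>*\<^bsub>G\<^esub> v)"

definition nbrs :: "real^'n^'n \<Rightarrow> 'n \<Rightarrow> 'n set" where
  "nbrs A i = {j. j \<noteq> i \<and> A $ i $ j > 0}"

definition protocol ::
    "real^'n^'n \<Rightarrow> ('n \<Rightarrow> 'n \<Rightarrow> real) \<Rightarrow> real^'n \<Rightarrow> real^'n" where
  "protocol A \<alpha> x = (\<chi> i. \<Sum>j\<in>nbrs A i. A $ i $ j * sig (x $ j - x $ i) (\<alpha> i j))"

text \<open>Time is \<open>[0, \<infinity>)\<close>: the derivative at \<open>0\<close> is one-sided, and values of \<open>x\<close> at negative
  times are irrelevant.\<close>

definition is_solution ::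
    "(real^'n \<Rightarrow> real^'n) \<Rightarrow> real^'n \<Rightarrow> (real \<Rightarrow> real^'n) \<Rightarrow> bool" where
  "is_solution u x0 x \<longleftrightarrow>
     x 0 = x0 \<and> (\<forall>t\<ge>0. (x has_vector_derivative u (x t)) (at t within {0..}))"

definition final_common_state :: "(real \<Rightarrow> real^'n) \<Rightarrow> real \<Rightarrow> bool" where
  "final_common_state x \<kappa> \<longleftrightarrow> (\<exists>t'\<ge>0. \<forall>t\<ge>t'. \<forall>j. x t $ j = \<kappa>)"

definition finite_time_consensus :: "(real^'n \<Rightarrow> real^'n) \<Rightarrow> bool" where
  "finite_time_consensus u \<longleftrightarrow>
     (\<forall>x0 x. is_solution u x0 x \<longrightarrow>
        (\<forall>j k. ((\<lambda>t. \<bar>x t $ j - x t $ k\<bar>) \<longlongrightarrow> 0) at_top) \<and>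
        (\<exists>\<kappa>. final_common_state x \<kappa>))"

text \<open>Quantifying over every final common state loses nothing: there is at most one, and
  \<^const>\<open>finite_time_consensus\<close> provides it.\<close>

definition finite_time_average_consensus :: "(real^'n \<Rightarrow> real^'n) \<Rightarrow> bool" where
  "finite_time_average_consensus u \<longleftrightarrow>
     finite_time_consensus u \<and>
     (\<forall>x0 x \<kappa>. is_solution u x0 x \<longrightarrow> final_common_state x \<kappa> \<longrightarrow>
        \<kappa> = (\<Sum>i\<in>UNIV. x0 $ i) / real CARD('n))"

end

theory Submission
  imports Defs
begin

text \<open>
  The Lyapunov function is the disagreement \<open>V = \<Sum>i. (x\<^sub>i - m)\<^sup>2\<close>, where \<open>m\<close> is the
  average of the initial state. As \<open>a\<^sub>i\<^sub>j = a\<^sub>j\<^sub>i\<close> and \<open>\<alpha>\<^sub>i\<^sub>j = \<alpha>\<^sub>j\<^sub>i\<close>, the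
  flow from \<open>j\<close> to \<open>i\<close> is opposite to the flow from \<open>i\<close> to \<open>j\<close>. Hence the sum of the states
  is conserved, \<open>m\<close> stays the average for all times, and pairing the two directions of every
  edge (\<open>sum_mult_antisymmetric\<close>) gives
  \<open>V' = - (\<Sum>i j. a\<^sub>i\<^sub>j * \<bar>x\<^sub>j - x\<^sub>i\<bar> powr (1 + \<alpha>\<^sub>i\<^sub>j))\<close>.

  Let \<open>a < 1\<close> bound all exponents. Along a solution \<open>V\<close> does not increase, so every difference
  \<open>\<bar>x\<^sub>j - x\<^sub>i\<bar>\<close> is at most \<open>s = sqrt (2 * V)\<close>, and \<open>s\<close> stays below a constant \<open>K\<close>. For
  \<open>d \<le> s \<le> K\<close> the subquadratic power \<open>d powr (1 + \<alpha>\<^sub>i\<^sub>j)\<close> dominates the square \<open>d\<^sup>2\<close> with a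
  factor of order \<open>s powr (a - 1)\<close>, the same for all edges (\<open>powr_ge_weighted_square\<close>). What
  remains is the quadratic energy \<open>\<Sum>i j. a\<^sub>i\<^sub>j * (x\<^sub>j - x\<^sub>i)\<^sup>2\<close>, and connectedness bounds it
  below by a multiple of \<open>V\<close> (\<open>poincare_inequality\<close>). Together these yield
  \<open>V' \<le> - c * V powr ((1 + a) / 2)\<close> with \<open>c > 0\<close> (\<open>dissipation_bound\<close>). The exponent is below
  one, so \<open>V\<close> reaches zero in finite time and stays there (\<open>eventually_zero_of_powr_decay\<close>).
\<close>

section \<open>Extinction in finite time\<close>

lemma nonincreasing_on_half_line:
  fixes V V' :: "real \<Rightarrow> real"
  assumes deriv: "\<And>t. 0 \<le> t \<Longrightarrow> (V has_real_derivative V' t) (at t within {0..})"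
    and nonpos: "\<And>t. 0 \<le> t \<Longrightarrow> V' t \<le> 0"
    and "0 \<le> s" "s \<le> t"
  shows "V t \<le> V s"
proof (rule DERIV_nonpos_imp_decreasing_open[of s t V])
  show "s \<le> t" by fact
  show "\<exists>y. (V has_real_derivative y) (at r) \<and> y \<le> 0" if "s < r" "r < t" for r
  proof (intro exI conjI)
    have "0 < r" using that \<open>0 \<le> s\<close> by linarith
    then show "(V has_real_derivative V' r) (at r)"
      using deriv[of r] at_within_interior[of r "{0..}"] by simp
    show "V' r \<le> 0" using \<open>0 < r\<close> by (intro nonpos) simp
  qed
  have "continuous_on {0..} V"
    by (rule DERIV_continuous_on[of _ _ V']) (use deriv in simp)
  then show "continuous_on {s..t} V"
    by (rule continuous_on_subset) (use \<open>0 \<le> s\<close> in auto)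
qed

text \<open>
  While \<open>V\<close> is positive, \<open>V powr (1 - \<beta>)\<close> has derivative at most \<open>- c * (1 - \<beta>)\<close>. It
  cannot become negative, so \<open>V\<close> vanishes no later than
  \<open>V 0 powr (1 - \<beta>) / (c * (1 - \<beta>))\<close>, and by monotonicity it never becomes positive again.
\<close>

lemma eventually_zero_of_powr_decay:
  fixes V V' :: "real \<Rightarrow> real" and c \<beta> :: real
  assumes nonneg: "\<And>t. 0 \<le> t \<Longrightarrow> 0 \<le> V t"
    and deriv: "\<And>t. 0 \<le> t \<Longrightarrow> (V has_real_derivative V' t) (at t within {0..})"
    and decay: "\<And>t. 0 \<le> t \<Longrightarrow> V' t \<le> - c * V t powr \<beta>"
    and c: "0 < c" and \<beta>: "\<beta> < 1"
  shows "\<exists>T\<ge>0. \<forall>t\<ge>T. V t = 0"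
proof -
  have deriv_at: "(V has_real_derivative V' t) (at t)" if "0 < t" for t
    using deriv[of t] at_within_interior[of t "{0..}"] that by simp
  have cont: "continuous_on {0..} V"
    by (rule DERIV_continuous_on[of _ _ V']) (use deriv in simp)
  have mono: "V t \<le> V s" if "0 \<le> s" "s \<le> t" for s t
  proof (rule nonincreasing_on_half_line[OF deriv])
    show "V' r \<le> 0" if "0 \<le> r" for r
      using decay[OF that] mult_nonneg_nonneg[of c "V r powr \<beta>"] c by (simp add: order.trans)
  qed (use that in auto)
  \<comment> \<open>The summand \<open>1\<close> makes \<open>T\<close> positive even if \<open>V 0 = 0\<close>, and the contradiction below strict.\<close>
  define T where "T = (V 0 powr (1 - \<beta>) + 1) / (c * (1 - \<beta>))"
  have "0 < T" unfolding T_def using c \<beta> by (intro divide_pos_pos add_nonneg_pos) auto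
  have "V T = 0"
  proof (rule ccontr)
    assume "V T \<noteq> 0"
    then have "0 < V T" using nonneg[of T] \<open>0 < T\<close> by simp
    then have pos: "0 < V t" if "0 \<le> t" "t \<le> T" for t
      using mono[of t T] that by linarith
    define W where "W t = V t powr (1 - \<beta>) + c * (1 - \<beta>) * t" for t
    have "W T \<le> W 0"
    proof (rule DERIV_nonpos_imp_decreasing_open[of 0 T W])
      show "0 \<le> T" using \<open>0 < T\<close> by simp
      show "\<exists>y. (W has_real_derivative y) (at r) \<and> y \<le> 0" if r: "0 < r" "r < T" for r
      proof (intro exI conjI)
        have Vr: "0 < V r" using pos r by simp
        show "(W has_real_derivative (1 - \<beta>) * V r powr (- \<beta>) * V' r + c * (1 - \<beta>)) (at r)"
          unfolding W_def
          by (rule DERIV_add DERIV_cmult_Id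
              DERIV_chain2[OF has_real_derivative_powr deriv_at[OF r(1)], OF Vr, of "1 - \<beta>", simplified])+
        have "V r powr (- \<beta>) * V' r \<le> V r powr (- \<beta>) * (- c * V r powr \<beta>)"
          by (intro mult_left_mono decay) (use r in auto)
        also have "\<dots> = - c" using Vr by (simp add: powr_minus field_simps)
        finally have "(1 - \<beta>) * (V r powr (- \<beta>) * V' r) \<le> (1 - \<beta>) * (- c)"
          using \<beta> by (intro mult_left_mono) auto
        then show "(1 - \<beta>) * V r powr (- \<beta>) * V' r + c * (1 - \<beta>) \<le> 0"
          by (simp add: algebra_simps)
      qed
      have "continuous_on {0..T} V"
        by (rule continuous_on_subset[OF cont]) auto
      then show "continuous_on {0..T} W"
        unfolding W_def using pos by (intro continuous_intros) (force+)
    qed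
    moreover have "c * (1 - \<beta>) * T = V 0 powr (1 - \<beta>) + 1"
      unfolding T_def using c \<beta> by simp
    ultimately have "V T powr (1 - \<beta>) \<le> - 1" unfolding W_def by simp
    then show False using powr_ge_zero[of "V T" "1 - \<beta>"] by linarith
  qed
  then have "V t = 0" if "T \<le> t" for t
    using mono[of T t] nonneg[of t] that \<open>0 < T\<close> by simp
  then show ?thesis using \<open>0 < T\<close> by (intro exI[of _ T]) auto
qed

section \<open>Sums over pairs of agents\<close>

text \<open>
  Discrete integration by parts: exchanging \<open>i\<close> and \<open>j\<close> moves the weight from one endpoint of an
  edge to the other. Constant \<open>z\<close> gives conservation of the total state; the deviation from
  the average gives the dissipation.
\<close>

lemma sum_mult_antisymmetric:
  fixes f :: "'n::finite \<Rightarrow> 'n \<Rightarrow> real"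
  assumes "\<And>i j. f j i = - f i j"
  shows "2 * (\<Sum>i\<in>UNIV. z i * (\<Sum>j\<in>UNIV. f i j)) = - (\<Sum>i\<in>UNIV. \<Sum>j\<in>UNIV. (z j - z i) * f i j)"
proof -
  have "(\<Sum>i\<in>UNIV. \<Sum>j\<in>UNIV. z j * f i j) = (\<Sum>j\<in>UNIV. \<Sum>i\<in>UNIV. z j * f i j)"
    by (rule sum.swap)
  also have "\<dots> = - (\<Sum>i\<in>UNIV. \<Sum>j\<in>UNIV. z i * f i j)"
    by (subst (2) assms) (simp add: sum_negf)
  finally show ?thesis
    by (simp add: sum_distrib_left left_diff_distrib sum_subtractf sum_negf)
qed

lemma sum_pairwise_squared_diff:
  fixes z :: "'n::finite \<Rightarrow> real"
  assumes "(\<Sum>i\<in>UNIV. z i) = 0"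
  shows "(\<Sum>i\<in>UNIV. \<Sum>j\<in>UNIV. (z j - z i)\<^sup>2) = 2 * real CARD('n) * (\<Sum>i\<in>UNIV. (z i)\<^sup>2)"
proof -
  have "(\<Sum>i\<in>UNIV. \<Sum>j\<in>UNIV. z j * z i) = 0"
    using assms by (simp flip: sum_distrib_right)
  moreover have "(\<Sum>i\<in>UNIV. \<Sum>j\<in>UNIV. (z j - z i)\<^sup>2) =
     (\<Sum>i\<in>(UNIV :: 'n set). \<Sum>j\<in>UNIV. (z j)\<^sup>2) + (\<Sum>i\<in>UNIV. \<Sum>j\<in>(UNIV :: 'n set). (z i)\<^sup>2)
      - 2 * (\<Sum>i\<in>UNIV. \<Sum>j\<in>UNIV. z j * z i)"
    by (simp add: power2_diff sum.distrib sum_subtractf sum_distrib_left mult.assoc)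
  ultimately show ?thesis by (simp add: sum_distrib_left mult.assoc)
qed

section \<open>The Poincare inequality of a connected graph\<close>

text \<open>
  Induction along a path from \<open>u\<close> to \<open>v\<close>: a new edge adds one difference, which is controlled by
  a single term of the energy, and \<open>(p + q)\<^sup>2 \<le> 2 * p\<^sup>2 + 2 * q\<^sup>2\<close>. The constant depends on
  the path but not on \<open>y\<close>.
\<close>

lemma squared_diff_le_edge_energy:
  fixes A :: "real^'n^'n"
  assumes nonneg: "\<And>i j. A $ i $ j \<ge> 0"
    and reach: "u \<rightarrow>\<^sup>*\<^bsub>weighted_graph A\<^esub> v"
  shows "\<exists>C\<ge>0. \<forall>y :: 'n \<Rightarrow> real.
    (y v - y u)\<^sup>2 \<le> C * (\<Sum>i\<in>UNIV. \<Sum>j\<in>UNIV. A $ i $ j * (y j - y i)\<^sup>2)"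
  using reach unfolding reachable_def
proof (induction rule: rtrancl_on.induct)
  case (rtrancl_on_refl v)
  then show ?case by (intro exI[of _ 0]) simp
next
  case (rtrancl_on_into_rtrancl_on u v w)
  then obtain C where C: "C \<ge> 0" and IH: "\<And>y :: 'n \<Rightarrow> real.
      (y v - y u)\<^sup>2 \<le> C * (\<Sum>i\<in>UNIV. \<Sum>j\<in>UNIV. A $ i $ j * (y j - y i)\<^sup>2)" by blast
  have a: "0 < A $ w $ v"
    using rtrancl_on_into_rtrancl_on.hyps
    by (auto simp: weighted_graph_def arcs_ends_def arc_to_ends_def)
  show ?case
  proof (intro exI[of _ "2 * C + 2 / A $ w $ v"] conjI allI)
    show "2 * C + 2 / A $ w $ v \<ge> 0" using C a by simp
    fix y :: "'n \<Rightarrow> real"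
    let ?Q = "\<Sum>i\<in>UNIV. \<Sum>j\<in>UNIV. A $ i $ j * (y j - y i)\<^sup>2"
    have "A $ w $ v * (y v - y w)\<^sup>2 \<le> (\<Sum>j\<in>UNIV. A $ w $ j * (y j - y w)\<^sup>2)"
      using nonneg by (intro member_le_sum) auto
    also have "\<dots> \<le> ?Q"
      using nonneg by (intro member_le_sum[of w UNIV "\<lambda>i. \<Sum>j\<in>UNIV. A $ i $ j * (y j - y i)\<^sup>2"])
        (auto intro!: sum_nonneg)
    finally have "(y v - y w)\<^sup>2 \<le> ?Q / A $ w $ v" using a by (simp add: field_simps)
    moreover have "(y w - y u)\<^sup>2 \<le> 2 * (y v - y u)\<^sup>2 + 2 * (y v - y w)\<^sup>2"
      using zero_le_power2[of "(y v - y u) + (y v - y w)"]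
      by (simp add: power2_eq_square algebra_simps)
    ultimately have "(y w - y u)\<^sup>2 \<le> 2 * (C * ?Q) + 2 * (?Q / A $ w $ v)"
      using IH[of y] by linarith
    then show "(y w - y u)\<^sup>2 \<le> (2 * C + 2 / A $ w $ v) * ?Q" by (simp add: algebra_simps)
  qed
qed

text \<open>
  For \<open>z\<close> of zero sum, \<open>\<Sum>i. (z i)\<^sup>2\<close> is a multiple of the sum of the squared differences over
  all pairs, and the previous lemma bounds each of these by the energy of the edges.
\<close>

lemma poincare_inequality:
  fixes A :: "real^'n^'n"
  assumes nonneg: "\<And>i j. A $ i $ j \<ge> 0"
    and conn: "graph_connected (weighted_graph A)"
  shows "\<exists>C>0. \<forall>z :: 'n \<Rightarrow> real. (\<Sum>i\<in>UNIV. z i) = 0 \<longrightarrow>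
    (\<Sum>i\<in>UNIV. (z i)\<^sup>2) \<le> C * (\<Sum>i\<in>UNIV. \<Sum>j\<in>UNIV. A $ i $ j * (z j - z i)\<^sup>2)"
proof -
  let ?Q = "\<lambda>z :: 'n \<Rightarrow> real. \<Sum>i\<in>UNIV. \<Sum>j\<in>UNIV. A $ i $ j * (z j - z i)\<^sup>2"
  have ex: "\<exists>C\<ge>0. \<forall>z. (z v - z u)\<^sup>2 \<le> C * ?Q z" for u v
  proof (cases "u = v")
    case True
    then show ?thesis by (intro exI[of _ 0]) simp
  next
    case False
    then have "u \<rightarrow>\<^sup>*\<^bsub>weighted_graph A\<^esub> v"
      using conn by (simp add: graph_connected_def weighted_graph_def)
    then show ?thesis by (rule squared_diff_le_edge_energy[OF nonneg])
  qed
  define C where "C u v = (SOME C. C \<ge> 0 \<and> (\<forall>z. (z v - z u)\<^sup>2 \<le> C * ?Q z))" for u v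
  have "C u v \<ge> 0 \<and> (\<forall>z. (z v - z u)\<^sup>2 \<le> C u v * ?Q z)" for u v
    unfolding C_def by (rule someI_ex) (rule ex)
  then have C0: "\<And>u v. C u v \<ge> 0" and C: "\<And>u v z. (z v - z u)\<^sup>2 \<le> C u v * ?Q z"
    by auto
  define K where "K = (\<Sum>u\<in>UNIV. \<Sum>v\<in>UNIV. C u v)"
  have "K \<ge> 0" unfolding K_def by (intro sum_nonneg C0)
  have Q0: "?Q z \<ge> 0" for z by (intro sum_nonneg) (simp add: nonneg)
  show ?thesis
  proof (intro exI[of _ "K + 1"] conjI allI impI)
    show "0 < K + 1" using \<open>K \<ge> 0\<close> by simp
    fix z :: "'n \<Rightarrow> real" assume z: "(\<Sum>i\<in>UNIV. z i) = 0"
    have "(\<Sum>i\<in>UNIV. (z i)\<^sup>2) \<le> 2 * real CARD('n) * (\<Sum>i\<in>UNIV. (z i)\<^sup>2)"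
    proof -
      have "1 \<le> real CARD('n)" by (simp add: Suc_le_eq)
      then have "1 \<le> 2 * real CARD('n)" by linarith
      then show ?thesis using mult_right_mono[of 1 "2 * real CARD('n)" "\<Sum>i\<in>UNIV. (z i)\<^sup>2"]
        by (simp add: sum_nonneg)
    qed
    also have "\<dots> = (\<Sum>u\<in>UNIV. \<Sum>v\<in>UNIV. (z v - z u)\<^sup>2)"
      by (rule sum_pairwise_squared_diff[OF z, symmetric])
    also have "\<dots> \<le> (\<Sum>u\<in>UNIV. \<Sum>v\<in>UNIV. C u v * ?Q z)" by (intro sum_mono C)
    also have "\<dots> = K * ?Q z" unfolding K_def by (simp only: sum_distrib_right)
    also have "\<dots> \<le> (K + 1) * ?Q z" using Q0 by (intro mult_right_mono) auto
    finally show "(\<Sum>i\<in>UNIV. (z i)\<^sup>2) \<le> (K + 1) * ?Q z" .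
  qed
qed

section \<open>Dissipation of the disagreement\<close>

text \<open>
  Replaces edge exponents \<open>e\<close> that differ from edge to edge by their common bound \<open>a\<close>. Write
  \<open>d powr (1 + e) = d powr (e - 1) * d\<^sup>2\<close>. As \<open>e - 1\<close> is negative, \<open>d\<close> may be replaced there by
  the larger \<open>s\<close>; splitting off \<open>s powr (a - 1)\<close> leaves \<open>s powr (e - a)\<close>, which is at least
  \<open>K powr (e - a)\<close> and so at least \<open>1 / K\<close>.
\<close>

lemma powr_ge_weighted_square:
  fixes d s K a e :: real
  assumes d: "0 \<le> d" "d \<le> s" and s: "s \<le> K" and K: "1 \<le> K" and e: "0 < e" "e \<le> a" "a < 1"
  shows "s powr (a - 1) / K * d\<^sup>2 \<le> d powr (1 + e)"
proof (cases "d = 0")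
  case False
  then have d0: "0 < d" and s0: "0 < s" using d by auto
  have "s powr (a - 1) / K \<le> s powr (a - 1) * K powr (e - a)"
    using powr_mono[of "-1" "e - a" K] e K
    by (simp add: divide_inverse powr_minus mult_left_mono)
  also have "\<dots> \<le> s powr (a - 1) * s powr (e - a)"
    using s s0 e by (intro mult_left_mono powr_mono2') auto
  also have "\<dots> = s powr (e - 1)" by (simp flip: powr_add)
  also have "\<dots> \<le> d powr (e - 1)" using d d0 e by (intro powr_mono2') auto
  finally have "s powr (a - 1) / K * d\<^sup>2 \<le> d powr (e - 1) * d\<^sup>2" by (intro mult_right_mono) auto
  also have "d powr (e - 1) * d\<^sup>2 = d powr (e - 1) * d powr 2"
    using d0 by simp
  also have "\<dots> = d powr (1 + e)" by (simp flip: powr_add add: add.commute)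
  finally show ?thesis .
qed simp

lemma sig_uminus: "sig (- r) e = - sig r e"
  by (simp add: sig_def sgn_minus)

lemma mult_sig: "r * sig r e = \<bar>r\<bar> powr (1 + e)"
proof (cases "r = 0")
  case False
  have "r * sig r e = \<bar>r\<bar> * \<bar>r\<bar> powr e" by (simp add: sig_def sgn_if)
  then show ?thesis using False by (simp add: powr_add)
qed (simp add: sig_def)

text \<open>
  The weights vanish off the neighbourhood, so the input is a sum over all agents, to which
  identities for double sums apply.
\<close>

lemma protocol_nth:
  fixes A :: "real^'n^'n"
  assumes "\<And>i j. A $ i $ j \<ge> 0" and "\<And>i. A $ i $ i = 0"
  shows "protocol A \<alpha> y $ i = (\<Sum>j\<in>UNIV. A $ i $ j * sig (y $ j - y $ i) (\<alpha> i j))"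
proof -
  have "A $ i $ j = 0" if "j \<notin> nbrs A i" for j
    using that assms(1)[of i j] assms(2)[of i] by (cases "j = i") (auto simp: nbrs_def)
  then show ?thesis
    unfolding protocol_def by (auto intro!: sum.mono_neutral_left)
qed

text \<open>
  Let \<open>V = \<Sum>i. (z i)\<^sup>2\<close>. All differences are at most \<open>s = sqrt (2 * V)\<close>, because \<open>(z j - z i)\<^sup>2 \<le> 2 * (z i)\<^sup>2 + 2 * (z j)\<^sup>2\<close>.
  Hence the dissipation is at least \<open>s powr (a - 1) / K\<close> times the quadratic energy, which the
  Poincare inequality bounds below by \<open>V / C\<close>. Since \<open>s\<close> is of order \<open>V powr (1 / 2)\<close>, the product
  is of order \<open>V powr ((1 + a) / 2)\<close>.
\<close>

lemma dissipation_bound: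
  fixes A :: "real^'n^'n" and z :: "'n \<Rightarrow> real"
  assumes nonneg: "\<And>i j. A $ i $ j \<ge> 0"
    and exponent: "\<And>i j. A $ i $ j \<noteq> 0 \<Longrightarrow> 0 < \<alpha> i j \<and> \<alpha> i j \<le> a" and a: "a < 1"
    and C: "0 < C" and poincare:
      "(\<Sum>i\<in>UNIV. (z i)\<^sup>2) \<le> C * (\<Sum>i\<in>UNIV. \<Sum>j\<in>UNIV. A $ i $ j * (z j - z i)\<^sup>2)"
    and K: "1 \<le> K" and bound: "2 * (\<Sum>i\<in>UNIV. (z i)\<^sup>2) \<le> K\<^sup>2"
  shows "2 powr ((a - 1) / 2) / (C * K) * (\<Sum>i\<in>UNIV. (z i)\<^sup>2) powr ((1 + a) / 2)
    \<le> (\<Sum>i\<in>UNIV. \<Sum>j\<in>UNIV. A $ i $ j * \<bar>z j - z i\<bar> powr (1 + \<alpha> i j))"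
proof -
  define V where "V = (\<Sum>i\<in>UNIV. (z i)\<^sup>2)"
  define s where "s = sqrt (2 * V)"
  let ?Q = "\<Sum>i\<in>UNIV. \<Sum>j\<in>UNIV. A $ i $ j * (z j - z i)\<^sup>2"
  have V: "0 \<le> V" unfolding V_def by (simp add: sum_nonneg)
  have s: "s \<le> K" unfolding s_def using bound K by (auto simp: V_def intro: real_le_lsqrt)
  have d: "\<bar>z j - z i\<bar> \<le> s" for i j
  proof (cases "i = j")
    case False
    have "(z i)\<^sup>2 + (z j)\<^sup>2 = (\<Sum>k\<in>{i, j}. (z k)\<^sup>2)" using False by simp
    also have "\<dots> \<le> V" unfolding V_def by (intro sum_mono2) auto
    finally have "\<bar>z j - z i\<bar>\<^sup>2 \<le> 2 * V"
      using zero_le_power2[of "z i + z j"] by (simp add: power2_eq_square algebra_simps)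
    then show ?thesis unfolding s_def by (rule real_le_rsqrt)
  qed (simp add: s_def V)
  have "V * s powr (a - 1) = 2 powr ((a - 1) / 2) * V powr ((1 + a) / 2)"
  proof (cases "V = 0")
    case False
    then have "0 < V" using V by simp
    have "s powr (a - 1) = (2 * V) powr ((a - 1) / 2)"
      using V by (simp add: s_def powr_half_sqrt[symmetric] powr_powr)
    moreover have "V powr ((1 + a) / 2) = V * V powr ((a - 1) / 2)"
      using \<open>0 < V\<close> powr_add[of V 1 "(a - 1) / 2"] by (simp add: field_simps)
    ultimately show ?thesis using V by (simp add: powr_mult)
  qed simp
  then have "2 powr ((a - 1) / 2) / (C * K) * V powr ((1 + a) / 2) = s powr (a - 1) / (C * K) * V"
    by (simp add: mult.commute)
  also have "\<dots> \<le> s powr (a - 1) / (C * K) * (C * ?Q)"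
    using poincare C K unfolding V_def by (intro mult_left_mono) auto
  also have "\<dots> = s powr (a - 1) / K * ?Q" using C by simp
  also have "\<dots> = (\<Sum>i\<in>UNIV. \<Sum>j\<in>UNIV. A $ i $ j * (s powr (a - 1) / K * \<bar>z j - z i\<bar>\<^sup>2))"
    by (simp add: sum_distrib_left mult_ac)
  also have "\<dots> \<le> (\<Sum>i\<in>UNIV. \<Sum>j\<in>UNIV. A $ i $ j * \<bar>z j - z i\<bar> powr (1 + \<alpha> i j))"
  proof (intro sum_mono)
    fix i j
    show "A $ i $ j * (s powr (a - 1) / K * \<bar>z j - z i\<bar>\<^sup>2)
        \<le> A $ i $ j * \<bar>z j - z i\<bar> powr (1 + \<alpha> i j)"
    proof (cases "A $ i $ j = 0")
      case False
      then show ?thesis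
        using exponent[of i j] nonneg[of i j] d s K a
        by (intro mult_left_mono powr_ge_weighted_square) auto
    qed simp
  qed
  finally show ?thesis unfolding V_def .
qed

lemma exponents_uniformly_below_one:
  fixes A :: "real^'n^'n" and \<alpha> :: "'n \<Rightarrow> 'n \<Rightarrow> real"
  assumes "\<And>i j. j \<in> nbrs A i \<Longrightarrow> \<alpha> i j < 1"
  obtains a where "a < 1" and "\<And>i j. j \<in> nbrs A i \<Longrightarrow> \<alpha> i j \<le> a"
proof
  let ?E = "insert 0 ((\<lambda>(i, j). \<alpha> i j) ` {(i, j). j \<in> nbrs A i})"
  have fin: "finite ?E" by simp
  then show "Max ?E < 1" using assms by (subst Max_less_iff) auto
  show "\<alpha> i j \<le> Max ?E" if "j \<in> nbrs A i" for i j
    using that by (intro Max_ge[OF fin]) auto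
qed

section \<open>Finite-time average consensus\<close>

theorem theorem2:
  fixes A :: "real^'n^'n" and \<alpha> :: "'n \<Rightarrow> 'n \<Rightarrow> real"
  assumes "\<And>i j. A $ i $ j \<ge> 0"
    and "\<And>i. A $ i $ i = 0"
    and "\<And>i j. j \<in> nbrs A i \<Longrightarrow> 0 < \<alpha> i j \<and> \<alpha> i j < 1"
    and "undirected A"
    and "graph_connected (weighted_graph A)"
    and "\<And>i j. j \<in> nbrs A i \<Longrightarrow> \<alpha> i j = \<alpha> j i"
  shows "finite_time_average_consensus (protocol A \<alpha>)"
proof -
  note nonneg = assms(1) and diag = assms(2) and exponent = assms(3)
  define f where "f y i j = A $ i $ j * sig (y $ j - y $ i) (\<alpha> i j)" for y :: "real^'n" and i j
  have u: "protocol A \<alpha> y $ i = (\<Sum>j\<in>UNIV. f y i j)" for y i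
    unfolding f_def by (rule protocol_nth[OF nonneg diag])
  have nbr: "j \<in> nbrs A i" if "A $ i $ j \<noteq> 0" for i j
    using that nonneg[of i j] diag[of i] by (auto simp: nbrs_def)
  have sym: "A $ j $ i = A $ i $ j" for i j
    using assms(4) by (simp add: undirected_def transpose_def vec_eq_iff)
  have anti: "f y j i = - f y i j" for y i j
  proof (cases "A $ i $ j = 0")
    case False
    then have "\<alpha> i j = \<alpha> j i" using nbr assms(6) by blast
    then show ?thesis
      using sig_uminus[of "y $ j - y $ i" "\<alpha> i j"] by (simp add: f_def sym[of j i])
  qed (simp add: f_def sym[of j i])
  obtain C where C: "0 < C" and poincare: "\<And>z :: 'n \<Rightarrow> real. (\<Sum>i\<in>UNIV. z i) = 0 \<Longrightarrow>
      (\<Sum>i\<in>UNIV. (z i)\<^sup>2) \<le> C * (\<Sum>i\<in>UNIV. \<Sum>j\<in>UNIV. A $ i $ j * (z j - z i)\<^sup>2)"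
    using poincare_inequality[OF nonneg assms(5)] by blast
  obtain a where a: "a < 1" and \<alpha>_le: "\<And>i j. j \<in> nbrs A i \<Longrightarrow> \<alpha> i j \<le> a"
    using exponents_uniformly_below_one[of A \<alpha>] exponent by blast
  define avg where "avg y = (\<Sum>i\<in>UNIV. y $ i) / real CARD('n)" for y :: "real^'n"
  have main: "\<exists>T\<ge>0. \<forall>t\<ge>T. \<forall>i. x t $ i = avg x0" if sol: "is_solution (protocol A \<alpha>) x0 x" for x0 x
  proof -
    have x0: "x 0 = x0" using sol by (simp add: is_solution_def)
    have x_deriv: "((\<lambda>t. x t $ i) has_real_derivative (\<Sum>j\<in>UNIV. f (x t) i j)) (at t within {0..})"
      if "0 \<le> t" for t i
    proof -
      have "(x has_vector_derivative protocol A \<alpha> (x t)) (at t within {0..})"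
        using sol that by (simp add: is_solution_def)
      then have "((\<lambda>t. x t $ i) has_vector_derivative protocol A \<alpha> (x t) $ i) (at t within {0..})"
        by (rule bounded_linear.has_vector_derivative[OF bounded_linear_vec_nth])
      then show ?thesis by (simp add: has_real_derivative_iff_has_vector_derivative u)
    qed
    have total: "(\<Sum>i\<in>UNIV. x t $ i) = real CARD('n) * avg x0" if "0 \<le> t" for t
    proof -
      have "((\<lambda>t. \<Sum>i\<in>UNIV. x t $ i) has_real_derivative 0) (at r within {0..})"
        if "r \<in> {0..}" for r
      proof -
        have "((\<lambda>t. \<Sum>i\<in>UNIV. x t $ i) has_real_derivative (\<Sum>i\<in>UNIV. \<Sum>j\<in>UNIV. f (x r) i j))
            (at r within {0..})"
          using that by (intro DERIV_sum x_deriv) simp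
        moreover have "(\<Sum>i\<in>UNIV. \<Sum>j\<in>UNIV. f (x r) i j) = 0"
          using sum_mult_antisymmetric[of "f (x r)" "\<lambda>_. 1", OF anti] by simp
        ultimately show ?thesis by simp
      qed
      then have "\<exists>c. \<forall>t\<in>{0..}. (\<Sum>i\<in>UNIV. x t $ i) = c"
        by (intro has_field_derivative_zero_constant) auto
      then have "(\<Sum>i\<in>UNIV. x t $ i) = (\<Sum>i\<in>UNIV. x 0 $ i)" using that by force
      then show ?thesis by (simp add: avg_def x0)
    qed
    define z where "z t i = x t $ i - avg x0" for t i
    have z_sum: "(\<Sum>i\<in>UNIV. z t i) = 0" if "0 \<le> t" for t
      using total[OF that] by (simp add: z_def sum_subtractf)
    define V where "V t = (\<Sum>i\<in>UNIV. (z t i)\<^sup>2)" for t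
    define P where "P t = (\<Sum>i\<in>UNIV. \<Sum>j\<in>UNIV. A $ i $ j * \<bar>z t j - z t i\<bar> powr (1 + \<alpha> i j))" for t
    have V_nonneg: "0 \<le> V t" for t by (simp add: V_def sum_nonneg)
    have V_deriv: "(V has_real_derivative - P t) (at t within {0..})" if "0 \<le> t" for t
    proof -
      have "(V has_real_derivative (\<Sum>i\<in>UNIV. 2 * (z t i * (\<Sum>j\<in>UNIV. f (x t) i j)))) (at t within {0..})"
        unfolding V_def z_def
        by (rule derivative_eq_intros x_deriv that refl | simp add: mult_ac)+
      also have "(\<Sum>i\<in>UNIV. 2 * (z t i * (\<Sum>j\<in>UNIV. f (x t) i j)))
          = - (\<Sum>i\<in>UNIV. \<Sum>j\<in>UNIV. (z t j - z t i) * f (x t) i j)"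
        unfolding sum_distrib_left[symmetric] by (rule sum_mult_antisymmetric) (rule anti)
      also have "\<dots> = - P t"
      proof -
        have "(z t j - z t i) * f (x t) i j = A $ i $ j * \<bar>z t j - z t i\<bar> powr (1 + \<alpha> i j)" for i j
          unfolding mult_sig[symmetric] by (simp add: f_def z_def)
        then show ?thesis by (simp add: P_def)
      qed
      finally show ?thesis .
    qed
    have P_nonneg: "0 \<le> P t" for t unfolding P_def by (simp add: sum_nonneg nonneg)
    have V_le: "V t \<le> V 0" if "0 \<le> t" for t
      using nonincreasing_on_half_line[OF V_deriv, of 0 t] P_nonneg that by simp
    \<comment> \<open>A bound for \<open>sqrt (2 * V t)\<close> at all times, raised by \<open>1\<close> to have \<open>1 \<le> K\<close>.\<close>
    define K where "K = sqrt (2 * V 0) + 1"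
    have K: "1 \<le> K" unfolding K_def using V_nonneg by simp
    have V0K: "2 * V 0 \<le> K\<^sup>2"
      using V_nonneg[of 0] by (simp add: K_def power2_sum)
    have "\<exists>T\<ge>0. \<forall>t\<ge>T. V t = 0"
    proof (rule eventually_zero_of_powr_decay[OF V_nonneg V_deriv])
      show "- P t \<le> - (2 powr ((a - 1) / 2) / (C * K)) * V t powr ((1 + a) / 2)" if "0 \<le> t" for t
      proof -
        have "2 powr ((a - 1) / 2) / (C * K) * V t powr ((1 + a) / 2) \<le> P t"
          unfolding V_def P_def
        proof (rule dissipation_bound[OF nonneg _ a C poincare K])
          show "0 < \<alpha> i j \<and> \<alpha> i j \<le> a" if "A $ i $ j \<noteq> 0" for i j
            using nbr[OF that] exponent \<alpha>_le by blast
          show "(\<Sum>i\<in>UNIV. z t i) = 0" using that by (rule z_sum)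
          show "2 * (\<Sum>i\<in>UNIV. (z t i)\<^sup>2) \<le> K\<^sup>2"
            using V_le[OF that] V0K unfolding V_def by linarith
        qed
        then show ?thesis by simp
      qed
      show "0 < 2 powr ((a - 1) / 2) / (C * K)" using C K by simp
      show "(1 + a) / 2 < 1" using a by simp
    qed
    moreover have "x t $ i = avg x0" if "V t = 0" for t i
    proof -
      have "\<forall>i\<in>UNIV. (z t i)\<^sup>2 = 0"
        using that unfolding V_def by (subst (asm) sum_nonneg_eq_0_iff) auto
      then show ?thesis by (simp add: z_def)
    qed
    ultimately show ?thesis by blast
  qed
  have consensus: "((\<lambda>t. \<bar>x t $ j - x t $ k\<bar>) \<longlongrightarrow> 0) at_top \<and> (\<exists>\<kappa>. final_common_state x \<kappa>)"
    if sol: "is_solution (protocol A \<alpha>) x0 x" for x0 x j k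
  proof -
    obtain T where T: "0 \<le> T" "\<And>t i. T \<le> t \<Longrightarrow> x t $ i = avg x0" using main[OF sol] by blast
    have "eventually (\<lambda>t. \<bar>x t $ j - x t $ k\<bar> = 0) at_top"
      using eventually_ge_at_top[of T] by eventually_elim (simp add: T)
    then have "((\<lambda>t. \<bar>x t $ j - x t $ k\<bar>) \<longlongrightarrow> 0) at_top" by (rule tendsto_eventually)
    then show ?thesis using T unfolding final_common_state_def by blast
  qed
  have average: "\<kappa> = avg x0"
    if sol: "is_solution (protocol A \<alpha>) x0 x" and final: "final_common_state x \<kappa>" for x0 x \<kappa>
  proof -
    obtain T where T: "\<And>t i. T \<le> t \<Longrightarrow> x t $ i = avg x0" using main[OF sol] by blast
    obtain T' where T': "\<And>t i. T' \<le> t \<Longrightarrow> x t $ i = \<kappa>"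
      using final unfolding final_common_state_def by blast
    show ?thesis using T[of "max T T'"] T'[of "max T T'"] by simp
  qed
  show ?thesis
    unfolding finite_time_average_consensus_def finite_time_consensus_def
    using consensus average unfolding avg_def by blast
qed

end
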